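(* Let $f\colon\mathsf{B}\to\mathsf{C}$ be a morphism of crossed modules such that the localization functor $\mathsf{L}_f\colon\mathsf{XMod}\to\mathsf{XMod}$ is a regular-epi localization functor. If the kernels $\ker(\ell^{\mathsf{T}}\colon\mathsf{T}\to\mathsf{L}_f\mathsf{T})$ of the localization morphisms are $\mathsf{L}_f$-acyclic for all crossed modules $\mathsf{T}$, then $\mathsf{L}_f$ is a nullification functor, i.e. there is a crossed module $\mathsf{A}$ such that $\mathsf{L}_f$ is naturally isomorphic, as a coaugmented functor, to $\mathsf{P}_{\mathsf{A}}$.
   Context: $\mathsf{XMod}$ is the category of crossed modules of groups: an object $\mathsf{T}=(T_1,T_2,\partial)$ is a group homomorphism $\partial\colon T_1\to T_2$ with an action of $T_2$ on $T_1$ by automorphisms such that $\partial({}^bt)=b\,\partial(t)\,b^{-1}$ and ${}^{\partial(t)}s=tst^{-1}$; morphisms are pairs of group homomorphisms compatible with connecting morphisms and actions. The zero object is the trivial crossed module $1$; a morphism is a regular epimorphism iff both its components are surjective. A localization functor is a functor $\mathsf{L}\colon\mathsf{XMod}\to\mathsf{XMod}$ with a natural transformation $\ell\colon\mathrm{Id}\to\mathsf{L}$ (the coaugmentation) such that $\ell^{\mathsf{L}\mathsf{X}}$ and $\mathsf{L}\ell^{\mathsf{X}}$ are isomorphisms for all $\mathsf{X}$. It is a regular-epi localization if $\ell^{\mathsf{T}}\colon\mathsf{T}\to\mathsf{L}\mathsf{T}$ is a regular epimorphism for every $\mathsf{T}$. A crossed module $\mathsf{X}$ is $\mathsf{L}$-acyclic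 if $\mathsf{L}\mathsf{X}\cong1$. For a morphism $f$ of crossed modules, a crossed module $\mathsf{T}$ is $\mathsf{L}_f$-local if $\mathrm{Hom}(f,\mathsf{T})$ is a bijection, and a morphism $u$ is an $\mathsf{L}_f$-equivalence if $\mathrm{Hom}(u,\mathsf{T})$ is a bijection for every $\mathsf{L}_f$-local $\mathsf{T}$. $\mathsf{L}_f$ denotes the localization functor (which exists) for which each $\mathsf{L}_f\mathsf{T}$ is $\mathsf{L}_f$-local and each $\ell^{\mathsf{T}}\colon\mathsf{T}\to\mathsf{L}_f\mathsf{T}$ is an $\mathsf{L}_f$-equivalence. For a crossed module $\mathsf{A}$, the nullification functor $\mathsf{P}_{\mathsf{A}}$ is $\mathsf{L}_f$ for $f\colon\mathsf{A}\to1$. *)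

theory Defs
  imports "HOL-Algebra.Bij" "HOL-Algebra.Elementary_Groups"
begin

section \<open>Crossed modules of groups\<close>

text \<open>
  \<open>grp1\<close> and \<open>grp2\<close> are the groups written $T_1$ and $T_2$, \<open>bd\<close> is the connecting
  morphism and \<open>act T b t\<close> is ${}^b t$.  The two groups share one element type; this is no
  restriction, as their carriers are arbitrary (possibly overlapping) subsets of it.
\<close>

record 'u xmod =
  grp1 :: "'u monoid"
  grp2 :: "'u monoid"
  bd :: "'u \<Rightarrow> 'u"
  act :: "'u \<Rightarrow> 'u \<Rightarrow> 'u"

text \<open>
  The multiplication of \<^const>\<open>AutoGroup\<close> is composition, so a homomorphism into it is a left
  action by group automorphisms.
\<close>

definition crossed_module :: "'u xmod \<Rightarrow> bool" where
  "crossed_module T \<longleftrightarrow>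
     group (grp1 T) \<and> group (grp2 T) \<and>
     bd T \<in> hom (grp1 T) (grp2 T) \<and>
     act T \<in> hom (grp2 T) (AutoGroup (grp1 T)) \<and>
     (\<forall>b \<in> carrier (grp2 T). \<forall>t \<in> carrier (grp1 T).
        bd T (act T b t) = b \<otimes>\<^bsub>grp2 T\<^esub> bd T t \<otimes>\<^bsub>grp2 T\<^esub> inv\<^bsub>grp2 T\<^esub> b) \<and>
     (\<forall>t \<in> carrier (grp1 T). \<forall>s \<in> carrier (grp1 T).
        act T (bd T t) s = t \<otimes>\<^bsub>grp1 T\<^esub> s \<otimes>\<^bsub>grp1 T\<^esub> inv\<^bsub>grp1 T\<^esub> t)"

text \<open>
  Morphisms are pairs of extensional functions (\<^const>\<open>undefined\<close> off the carrier), so that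
  equality in HOL is equality of morphisms and the sets \<open>Hom T S\<close> are genuine hom-sets.
\<close>

type_synonym 'u xmor = "('u \<Rightarrow> 'u) \<times> ('u \<Rightarrow> 'u)"

definition Hom :: "'u xmod \<Rightarrow> 'u xmod \<Rightarrow> 'u xmor set" where
  "Hom T S = {(f1, f2).
     f1 \<in> hom (grp1 T) (grp1 S) \<and> f1 \<in> extensional (carrier (grp1 T)) \<and>
     f2 \<in> hom (grp2 T) (grp2 S) \<and> f2 \<in> extensional (carrier (grp2 T)) \<and>
     (\<forall>t \<in> carrier (grp1 T). f2 (bd T t) = bd S (f1 t)) \<and>
     (\<forall>b \<in> carrier (grp2 T). \<forall>t \<in> carrier (grp1 T). f1 (act T b t) = act S (f2 b) (f1 t))}"

text \<open>
  \<open>Comp T g f\<close> is $g \circ f$, where \<open>T\<close> is the source of \<open>f\<close>.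
\<close>

definition Comp :: "'u xmod \<Rightarrow> 'u xmor \<Rightarrow> 'u xmor \<Rightarrow> 'u xmor" where
  "Comp T g f = (compose (carrier (grp1 T)) (fst g) (fst f),
                 compose (carrier (grp2 T)) (snd g) (snd f))"

definition Ident :: "'u xmod \<Rightarrow> 'u xmor" where
  "Ident T = (\<lambda>t \<in> carrier (grp1 T). t, \<lambda>b \<in> carrier (grp2 T). b)"

definition iso_mor :: "'u xmod \<Rightarrow> 'u xmod \<Rightarrow> 'u xmor \<Rightarrow> bool" where
  "iso_mor T S f \<longleftrightarrow>
     f \<in> Hom T S \<and> (\<exists>g \<in> Hom S T. Comp T g f = Ident T \<and> Comp S f g = Ident S)"

definition isomorphic :: "'u xmod \<Rightarrow> 'u xmod \<Rightarrow> bool" where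
  "isomorphic T S \<longleftrightarrow> (\<exists>f. iso_mor T S f)"

definition trivial_xmod :: "'u xmod" where
  "trivial_xmod = \<lparr>grp1 = singleton_group undefined, grp2 = singleton_group undefined,
     bd = (\<lambda>_. undefined), act = (\<lambda>_. \<lambda>t \<in> {undefined}. t)\<rparr>"

definition to_trivial :: "'u xmod \<Rightarrow> 'u xmor" where
  "to_trivial T = (\<lambda>_ \<in> carrier (grp1 T). \<one>\<^bsub>grp1 trivial_xmod\<^esub>,
                   \<lambda>_ \<in> carrier (grp2 T). \<one>\<^bsub>grp2 trivial_xmod\<^esub>)"

definition ker :: "'u xmod \<Rightarrow> 'u xmod \<Rightarrow> 'u xmor \<Rightarrow> 'u xmod" where
  "ker T S f =
     \<lparr>grp1 = (grp1 T)\<lparr>carrier := kernel (grp1 T) (grp1 S) (fst f)\<rparr>,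
      grp2 = (grp2 T)\<lparr>carrier := kernel (grp2 T) (grp2 S) (snd f)\<rparr>,
      bd = bd T,
      act = (\<lambda>b. restrict (act T b) (kernel (grp1 T) (grp1 S) (fst f)))\<rparr>"


section \<open>The category \<open>XMod\<close>, relative to a universe of small sets\<close>

text \<open>
  A functor on \<open>XMod\<close> acts on all (small) crossed modules, so the notion of a small set has to
  be fixed.  It is given by a predicate on the subsets of a type \<open>'u\<close>, of which we require only
  that some infinite set is small and that sets no larger than a small set are small.  The small
  sets of a Grothendieck universe (with infinite elements) are of this kind, and so are all
  subsets of an infinite type, or the countable ones.  Small sets are automatically closed
  under binary products (up to bijection).
\<close>

definition universe :: "('u set \<Rightarrow> bool) \<Rightarrow> bool" where
  "universe small \<longleftrightarrow>
     (\<exists>X. small X \<and> infinite X) \<and>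
     (\<forall>X Y. small X \<longrightarrow> Y \<subseteq> X \<longrightarrow> small Y) \<and>
     (\<forall>X (h :: 'u \<Rightarrow> 'u). small X \<longrightarrow> small (h ` X))"

definition XMod :: "('u set \<Rightarrow> bool) \<Rightarrow> 'u xmod set" where
  "XMod small =
     {T. crossed_module T \<and> small (carrier (grp1 T)) \<and> small (carrier (grp2 T))}"

text \<open>
  A regular epimorphism is a coequalizer of some parallel pair.
\<close>

definition regular_epi ::
  "('u set \<Rightarrow> bool) \<Rightarrow> 'u xmod \<Rightarrow> 'u xmod \<Rightarrow> 'u xmor \<Rightarrow> bool" where
  "regular_epi small T S e \<longleftrightarrow>
     e \<in> Hom T S \<and>
     (\<exists>X \<in> XMod small. \<exists>p \<in> Hom X T. \<exists>q \<in> Hom X T.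
        Comp X e p = Comp X e q \<and>
        (\<forall>Z \<in> XMod small. \<forall>g \<in> Hom T Z. Comp X g p = Comp X g q \<longrightarrow>
           (\<exists>!k. k \<in> Hom S Z \<and> Comp T k e = g)))"


section \<open>Localization functors\<close>

text \<open>
  \<open>Mor L T S\<close> is the action of \<open>L\<close> on \<open>Hom T S\<close>, and \<open>coaug L T\<close> is the component at \<open>T\<close> of
  the natural transformation from the identity to \<open>L\<close>.
\<close>

record 'u coaugmented =
  Obj :: "'u xmod \<Rightarrow> 'u xmod"
  Mor :: "'u xmod \<Rightarrow> 'u xmod \<Rightarrow> 'u xmor \<Rightarrow> 'u xmor"
  coaug :: "'u xmod \<Rightarrow> 'u xmor"

definition endofunctor :: "('u set \<Rightarrow> bool) \<Rightarrow> 'u coaugmented \<Rightarrow> bool" where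
  "endofunctor small L \<longleftrightarrow>
     (\<forall>T \<in> XMod small. Obj L T \<in> XMod small) \<and>
     (\<forall>T \<in> XMod small. \<forall>S \<in> XMod small. \<forall>f \<in> Hom T S.
        Mor L T S f \<in> Hom (Obj L T) (Obj L S)) \<and>
     (\<forall>T \<in> XMod small. Mor L T T (Ident T) = Ident (Obj L T)) \<and>
     (\<forall>T \<in> XMod small. \<forall>S \<in> XMod small. \<forall>R \<in> XMod small. \<forall>f \<in> Hom T S. \<forall>g \<in> Hom S R.
        Mor L T R (Comp T g f) = Comp (Obj L T) (Mor L S R g) (Mor L T S f))"

definition coaugmented_functor :: "('u set \<Rightarrow> bool) \<Rightarrow> 'u coaugmented \<Rightarrow> bool" where
  "coaugmented_functor small L \<longleftrightarrow>
     endofunctor small L \<and>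
     (\<forall>T \<in> XMod small. coaug L T \<in> Hom T (Obj L T)) \<and>
     (\<forall>T \<in> XMod small. \<forall>S \<in> XMod small. \<forall>f \<in> Hom T S.
        Comp T (coaug L S) f = Comp T (Mor L T S f) (coaug L T))"

definition localization_functor :: "('u set \<Rightarrow> bool) \<Rightarrow> 'u coaugmented \<Rightarrow> bool" where
  "localization_functor small L \<longleftrightarrow>
     coaugmented_functor small L \<and>
     (\<forall>X \<in> XMod small.
        iso_mor (Obj L X) (Obj L (Obj L X)) (coaug L (Obj L X)) \<and>
        iso_mor (Obj L X) (Obj L (Obj L X)) (Mor L X (Obj L X) (coaug L X)))"

definition regular_epi_localization :: "('u set \<Rightarrow> bool) \<Rightarrow> 'u coaugmented \<Rightarrow> bool" where
  "regular_epi_localization small L \<longleftrightarrow>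
     localization_functor small L \<and>
     (\<forall>T \<in> XMod small. regular_epi small T (Obj L T) (coaug L T))"

definition acyclic_xmod :: "'u coaugmented \<Rightarrow> 'u xmod \<Rightarrow> bool" where
  "acyclic_xmod L X \<longleftrightarrow> isomorphic (Obj L X) trivial_xmod"

text \<open>
  In the following three definitions \<open>f\<close> is a morphism from \<open>B\<close> to \<open>C\<close>.
\<close>

definition local_xmod ::
  "('u set \<Rightarrow> bool) \<Rightarrow> 'u xmod \<Rightarrow> 'u xmod \<Rightarrow> 'u xmor \<Rightarrow> 'u xmod \<Rightarrow> bool" where
  "local_xmod small B C f T \<longleftrightarrow>
     T \<in> XMod small \<and> bij_betw (\<lambda>g. Comp B g f) (Hom C T) (Hom B T)"

definition local_equivalence ::
  "('u set \<Rightarrow> bool) \<Rightarrow> 'u xmod \<Rightarrow> 'u xmod \<Rightarrow> 'u xmor \<Rightarrow>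
     'u xmod \<Rightarrow> 'u xmod \<Rightarrow> 'u xmor \<Rightarrow> bool" where
  "local_equivalence small B C f X Y u \<longleftrightarrow>
     u \<in> Hom X Y \<and>
     (\<forall>T. local_xmod small B C f T \<longrightarrow> bij_betw (\<lambda>g. Comp X g u) (Hom Y T) (Hom X T))"

text \<open>
  The localization at \<open>f\<close> is determined only up to a unique isomorphism of coaugmented
  functors, so it is a property of \<open>L\<close> to be one.
\<close>

definition is_localization_at ::
  "('u set \<Rightarrow> bool) \<Rightarrow> 'u xmod \<Rightarrow> 'u xmod \<Rightarrow> 'u xmor \<Rightarrow> 'u coaugmented \<Rightarrow> bool" where
  "is_localization_at small B C f L \<longleftrightarrow>
     localization_functor small L \<and>
     (\<forall>T \<in> XMod small.
        local_xmod small B C f (Obj L T) \<and>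
        local_equivalence small B C f T (Obj L T) (coaug L T))"

definition is_nullification ::
  "('u set \<Rightarrow> bool) \<Rightarrow> 'u xmod \<Rightarrow> 'u coaugmented \<Rightarrow> bool" where
  "is_nullification small A P \<longleftrightarrow> is_localization_at small A trivial_xmod (to_trivial A) P"

definition coaugmented_iso ::
  "('u set \<Rightarrow> bool) \<Rightarrow> 'u coaugmented \<Rightarrow> 'u coaugmented \<Rightarrow> bool" where
  "coaugmented_iso small L P \<longleftrightarrow>
     (\<exists>\<theta> :: 'u xmod \<Rightarrow> 'u xmor.
        (\<forall>T \<in> XMod small. iso_mor (Obj L T) (Obj P T) (\<theta> T)) \<and>
        (\<forall>T \<in> XMod small. \<forall>S \<in> XMod small. \<forall>f \<in> Hom T S.
           Comp (Obj L T) (\<theta> S) (Mor L T S f) = Comp (Obj L T) (Mor P T S f) (\<theta> T)) \<and>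
        (\<forall>T \<in> XMod small. Comp T (\<theta> T) (coaug L T) = coaug P T))"

end

theory Submission
  imports Defs "HOL-Algebra.Weak_Morphisms"
begin

text \<open>
  The idea is to find a crossed module \<open>A\<close> such that \<open>f\<close> and the morphism \<open>A \<rightarrow> 1\<close> have the same
  local objects.  These determine the equivalences, hence also which functors are localizations at the morphism
  (\<open>is_localization_at_cong\<close>), so \<open>L\<close> itself is then a nullification at \<open>A\<close>; and the universal
  property of the coaugmentations makes any other one isomorphic to \<open>L\<close>
  (\<open>localization_unique\<close>).

  Let \<open>A\<close> be the product of the kernels \<open>K B\<close> and \<open>K C\<close> of the coaugmentations of \<open>B\<close> and \<open>C\<close>.
  An object \<open>Z\<close> is local for \<open>A \<rightarrow> 1\<close> iff only the zero morphism goes from \<open>A\<close> to \<open>Z\<close>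
  (\<open>local_at_to_trivial_iff\<close>), which means that only zero morphisms go from \<open>K B\<close> and \<open>K C\<close> to \<open>Z\<close>
  (\<open>null_product_exists\<close>).  The product does here what one would expect of the coproduct,
  because the factors are retracts of the product and generate it; and it is much easier to
  construct.

  If \<open>Z\<close> is local for \<open>f\<close>, every morphism from an acyclic crossed module to \<open>Z\<close> is zero, and the
  kernels are acyclic by hypothesis (\<open>acyclic_null_local\<close>).  Conversely, suppose that only zero
  morphisms go from the kernels to \<open>Z\<close>.  A regular epimorphism is a cokernel of its kernel, so
  the morphisms from \<open>B\<close> and \<open>C\<close> to \<open>Z\<close> correspond to those from \<open>L B\<close> and \<open>L C\<close>
  (\<open>regular_epi_factor\<close>, \<open>regular_epi_cancel\<close>).  Since \<open>L f\<close> is an isomorphism, composition with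
  \<open>f\<close> is a bijection from the morphisms \<open>C \<rightarrow> Z\<close> to the morphisms \<open>B \<rightarrow> Z\<close>
  (\<open>local_if_null_kernels\<close>).
\<close>

section \<open>Crossed modules through elements\<close>

lemma crossed_moduleD:
  assumes "crossed_module T"
  shows "group (grp1 T)" and "group (grp2 T)" and "bd T \<in> hom (grp1 T) (grp2 T)"
    and "\<And>t. t \<in> carrier (grp1 T) \<Longrightarrow> bd T t \<in> carrier (grp2 T)"
    and "\<And>b t. b \<in> carrier (grp2 T) \<Longrightarrow> t \<in> carrier (grp1 T) \<Longrightarrow> act T b t \<in> carrier (grp1 T)"
    and "\<And>b. b \<in> carrier (grp2 T) \<Longrightarrow> act T b \<in> extensional (carrier (grp1 T))"
    and "\<And>b s t. b \<in> carrier (grp2 T) \<Longrightarrow> s \<in> carrier (grp1 T) \<Longrightarrow> t \<in> carrier (grp1 T) \<Longrightarrow>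
           act T b (s \<otimes>\<^bsub>grp1 T\<^esub> t) = act T b s \<otimes>\<^bsub>grp1 T\<^esub> act T b t"
    and "\<And>b. b \<in> carrier (grp2 T) \<Longrightarrow> act T b \<one>\<^bsub>grp1 T\<^esub> = \<one>\<^bsub>grp1 T\<^esub>"
    and "\<And>a b t. a \<in> carrier (grp2 T) \<Longrightarrow> b \<in> carrier (grp2 T) \<Longrightarrow> t \<in> carrier (grp1 T) \<Longrightarrow>
           act T (a \<otimes>\<^bsub>grp2 T\<^esub> b) t = act T a (act T b t)"
    and "\<And>t. t \<in> carrier (grp1 T) \<Longrightarrow> act T \<one>\<^bsub>grp2 T\<^esub> t = t"
    and "\<And>b t. b \<in> carrier (grp2 T) \<Longrightarrow> t \<in> carrier (grp1 T) \<Longrightarrow>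
           bd T (act T b t) = b \<otimes>\<^bsub>grp2 T\<^esub> bd T t \<otimes>\<^bsub>grp2 T\<^esub> inv\<^bsub>grp2 T\<^esub> b"
    and "\<And>s t. s \<in> carrier (grp1 T) \<Longrightarrow> t \<in> carrier (grp1 T) \<Longrightarrow>
           act T (bd T t) s = t \<otimes>\<^bsub>grp1 T\<^esub> s \<otimes>\<^bsub>grp1 T\<^esub> inv\<^bsub>grp1 T\<^esub> t"
proof -
  note T = assms[unfolded crossed_module_def]
  show G1: "group (grp1 T)" and G2: "group (grp2 T)" and bd: "bd T \<in> hom (grp1 T) (grp2 T)"
    using T by auto
  show "\<And>t. t \<in> carrier (grp1 T) \<Longrightarrow> bd T t \<in> carrier (grp2 T)"
    using bd by (rule hom_in_carrier)
  have act: "act T \<in> hom (grp2 T) (AutoGroup (grp1 T))" using T by auto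
  have auto: "act T b \<in> hom (grp1 T) (grp1 T)" "act T b \<in> Bij (carrier (grp1 T))"
    if "b \<in> carrier (grp2 T)" for b
    using hom_in_carrier[OF act that] by (auto simp: AutoGroup_def auto_def)
  show closed: "act T b t \<in> carrier (grp1 T)"
    if "b \<in> carrier (grp2 T)" "t \<in> carrier (grp1 T)" for b t
    using auto(1)[OF that(1)] that(2) by (rule hom_in_carrier)
  show "act T b \<in> extensional (carrier (grp1 T))" if "b \<in> carrier (grp2 T)" for b
    using auto(2)[OF that] by (rule Bij_imp_extensional)
  show "act T b (s \<otimes>\<^bsub>grp1 T\<^esub> t) = act T b s \<otimes>\<^bsub>grp1 T\<^esub> act T b t"
    if "b \<in> carrier (grp2 T)" "s \<in> carrier (grp1 T)" "t \<in> carrier (grp1 T)" for b s t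
    using hom_mult[OF auto(1)[OF that(1)] that(2,3)] .
  show "act T b \<one>\<^bsub>grp1 T\<^esub> = \<one>\<^bsub>grp1 T\<^esub>" if "b \<in> carrier (grp2 T)" for b
    using hom_one[OF auto(1)[OF that] G1 G1] .
  show "act T (a \<otimes>\<^bsub>grp2 T\<^esub> b) t = act T a (act T b t)"
    if "a \<in> carrier (grp2 T)" "b \<in> carrier (grp2 T)" "t \<in> carrier (grp1 T)" for a b t
    using hom_mult[OF act that(1,2)] auto(2) that
    by (simp add: AutoGroup_def BijGroup_def compose_def)
  have "group (AutoGroup (grp1 T))"
    using group.AutoGroup[OF G1] .
  then have "act T \<one>\<^bsub>grp2 T\<^esub> = \<one>\<^bsub>AutoGroup (grp1 T)\<^esub>"
    using hom_one[OF act G2] by blast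
  then show "act T \<one>\<^bsub>grp2 T\<^esub> t = t" if "t \<in> carrier (grp1 T)" for t
    using that by (simp add: AutoGroup_def BijGroup_def)
qed (use assms in \<open>auto simp: crossed_module_def\<close>)

text \<open>
  An action by endomorphisms in which the neutral element acts as the identity is automatically
  an action by automorphisms, the inverse of the action of \<open>b\<close> being that of the inverse of \<open>b\<close>.
\<close>

lemma crossed_moduleI:
  assumes G1: "group (grp1 T)" and G2: "group (grp2 T)" and bd: "bd T \<in> hom (grp1 T) (grp2 T)"
    and closed: "\<And>b t. b \<in> carrier (grp2 T) \<Longrightarrow> t \<in> carrier (grp1 T) \<Longrightarrow>
           act T b t \<in> carrier (grp1 T)"
    and ext: "\<And>b. b \<in> carrier (grp2 T) \<Longrightarrow> act T b \<in> extensional (carrier (grp1 T))"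
    and mult: "\<And>b s t. b \<in> carrier (grp2 T) \<Longrightarrow> s \<in> carrier (grp1 T) \<Longrightarrow> t \<in> carrier (grp1 T) \<Longrightarrow>
           act T b (s \<otimes>\<^bsub>grp1 T\<^esub> t) = act T b s \<otimes>\<^bsub>grp1 T\<^esub> act T b t"
    and act_mult: "\<And>a b t. a \<in> carrier (grp2 T) \<Longrightarrow> b \<in> carrier (grp2 T) \<Longrightarrow> t \<in> carrier (grp1 T) \<Longrightarrow>
           act T (a \<otimes>\<^bsub>grp2 T\<^esub> b) t = act T a (act T b t)"
    and act_one: "\<And>t. t \<in> carrier (grp1 T) \<Longrightarrow> act T \<one>\<^bsub>grp2 T\<^esub> t = t"
    and "\<And>b t. b \<in> carrier (grp2 T) \<Longrightarrow> t \<in> carrier (grp1 T) \<Longrightarrow>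
           bd T (act T b t) = b \<otimes>\<^bsub>grp2 T\<^esub> bd T t \<otimes>\<^bsub>grp2 T\<^esub> inv\<^bsub>grp2 T\<^esub> b"
    and "\<And>s t. s \<in> carrier (grp1 T) \<Longrightarrow> t \<in> carrier (grp1 T) \<Longrightarrow>
           act T (bd T t) s = t \<otimes>\<^bsub>grp1 T\<^esub> s \<otimes>\<^bsub>grp1 T\<^esub> inv\<^bsub>grp1 T\<^esub> t"
  shows "crossed_module T"
proof -
  interpret G2: group "grp2 T" by (rule G2)
  have bij: "act T b \<in> Bij (carrier (grp1 T))" if b: "b \<in> carrier (grp2 T)" for b
  proof -
    have "bij_betw (act T b) (carrier (grp1 T)) (carrier (grp1 T))"
      by (rule bij_betw_byWitness[where f' = "act T (inv\<^bsub>grp2 T\<^esub> b)"])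
        (use b closed act_one in \<open>auto simp: act_mult[symmetric]\<close>)
    then show ?thesis using ext[OF b] by (simp add: Bij_def)
  qed
  have "act T b \<in> carrier (AutoGroup (grp1 T))" if "b \<in> carrier (grp2 T)" for b
    using bij[OF that] closed[OF that] mult[OF that]
    by (auto simp: AutoGroup_def auto_def intro!: homI)
  moreover have "act T (a \<otimes>\<^bsub>grp2 T\<^esub> b) = act T a \<otimes>\<^bsub>AutoGroup (grp1 T)\<^esub> act T b"
    if "a \<in> carrier (grp2 T)" "b \<in> carrier (grp2 T)" for a b
  proof (rule extensionalityI[of _ "carrier (grp1 T)"])
    show "act T (a \<otimes>\<^bsub>grp2 T\<^esub> b) \<in> extensional (carrier (grp1 T))"
      using that by (intro ext) simp
  qed (use that bij in \<open>auto simp: AutoGroup_def BijGroup_def compose_def act_mult\<close>)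
  ultimately have "act T \<in> hom (grp2 T) (AutoGroup (grp1 T))"
    by (intro homI)
  then show ?thesis
    using assms by (simp add: crossed_module_def)
qed

section \<open>Composition of morphisms\<close>

lemma Hom_iff:
  "f \<in> Hom T S \<longleftrightarrow>
     fst f \<in> hom (grp1 T) (grp1 S) \<and> fst f \<in> extensional (carrier (grp1 T)) \<and>
     snd f \<in> hom (grp2 T) (grp2 S) \<and> snd f \<in> extensional (carrier (grp2 T)) \<and>
     (\<forall>t \<in> carrier (grp1 T). snd f (bd T t) = bd S (fst f t)) \<and>
     (\<forall>b \<in> carrier (grp2 T). \<forall>t \<in> carrier (grp1 T).
        fst f (act T b t) = act S (snd f b) (fst f t))"
  by (cases f) (simp add: Hom_def)

lemma Hom_closed:
  assumes "f \<in> Hom T S"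
  shows "t \<in> carrier (grp1 T) \<Longrightarrow> fst f t \<in> carrier (grp1 S)"
    and "b \<in> carrier (grp2 T) \<Longrightarrow> snd f b \<in> carrier (grp2 S)"
  using assms by (auto simp: Hom_iff dest: hom_in_carrier)

lemma Hom_group_hom:
  assumes "f \<in> Hom T S" "crossed_module T" "crossed_module S"
  shows "group_hom (grp1 T) (grp1 S) (fst f)" and "group_hom (grp2 T) (grp2 S) (snd f)"
  using assms by (auto simp: Hom_iff group_hom_def group_hom_axioms_def crossed_moduleD)

lemma Hom_eqI:
  assumes "f \<in> Hom T S" "g \<in> Hom T R"
    and "\<And>t. t \<in> carrier (grp1 T) \<Longrightarrow> fst f t = fst g t"
    and "\<And>b. b \<in> carrier (grp2 T) \<Longrightarrow> snd f b = snd g b"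
  shows "f = g"
  using assms by (auto simp: Hom_iff prod_eq_iff intro: extensionalityI)

lemma Comp_apply [simp]:
  "t \<in> carrier (grp1 T) \<Longrightarrow> fst (Comp T g f) t = fst g (fst f t)"
  "b \<in> carrier (grp2 T) \<Longrightarrow> snd (Comp T g f) b = snd g (snd f b)"
  by (simp_all add: Comp_def compose_def)

lemma Comp_in_Hom:
  assumes "crossed_module T" "f \<in> Hom T S" "g \<in> Hom S R"
  shows "Comp T g f \<in> Hom T R"
proof -
  note T = crossed_moduleD[OF assms(1)] and f = Hom_closed[OF assms(2)]
  have "fst (Comp T g f) \<in> hom (grp1 T) (grp1 R)" "snd (Comp T g f) \<in> hom (grp2 T) (grp2 R)"
    using assms by (auto simp: Hom_iff Comp_def 
        intro: group.hom_compose[OF T(1)] group.hom_compose[OF T(2)])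
  then show ?thesis
    using assms(2,3) f T by (auto simp: Hom_iff) (auto simp: Comp_def compose_def)
qed

lemma Comp_assoc:
  assumes "f \<in> Hom T S"
  shows "Comp T h (Comp T g f) = Comp T (Comp S h g) f"
  using Hom_closed[OF assms] by (auto simp: Comp_def compose_def fun_eq_iff restrict_def)

lemma Ident_apply [simp]:
  "t \<in> carrier (grp1 T) \<Longrightarrow> fst (Ident T) t = t"
  "b \<in> carrier (grp2 T) \<Longrightarrow> snd (Ident T) b = b"
  by (simp_all add: Ident_def)

lemma Ident_in_Hom:
  assumes "crossed_module T"
  shows "Ident T \<in> Hom T T"
  using crossed_moduleD[OF assms]
  by (auto simp: Hom_iff Ident_def hom_def group.is_monoid monoid.m_closed)

lemma Comp_Ident_left:
  assumes "crossed_module T" "crossed_module S" "f \<in> Hom T S"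
  shows "Comp T (Ident S) f = f"
  using Hom_closed[OF assms(3)] Comp_in_Hom[OF assms(1,3) Ident_in_Hom[OF assms(2)]] assms(3)
  by (auto intro!: Hom_eqI)

lemma Comp_Ident_right:
  assumes "crossed_module T" "f \<in> Hom T S"
  shows "Comp T f (Ident T) = f"
  using Comp_in_Hom[OF assms(1) Ident_in_Hom[OF assms(1)] assms(2)] assms(2)
  by (auto intro!: Hom_eqI)

lemma XModD:
  assumes "T \<in> XMod small"
  shows "crossed_module T" "small (carrier (grp1 T))" "small (carrier (grp2 T))"
  using assms by (auto simp: XMod_def)

section \<open>Crossed modules without nonzero morphisms between them\<close>

definition zero_mor :: "'u xmod \<Rightarrow> 'u xmod \<Rightarrow> 'u xmor" where
  "zero_mor A T = (\<lambda>_ \<in> carrier (grp1 A). \<one>\<^bsub>grp1 T\<^esub>, \<lambda>_ \<in> carrier (grp2 A). \<one>\<^bsub>grp2 T\<^esub>)"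

definition null :: "'u xmod \<Rightarrow> 'u xmod \<Rightarrow> bool" where
  "null A T \<longleftrightarrow> Hom A T = {zero_mor A T}"

lemma zero_mor_apply [simp]:
  "t \<in> carrier (grp1 A) \<Longrightarrow> fst (zero_mor A T) t = \<one>\<^bsub>grp1 T\<^esub>"
  "b \<in> carrier (grp2 A) \<Longrightarrow> snd (zero_mor A T) b = \<one>\<^bsub>grp2 T\<^esub>"
  by (simp_all add: zero_mor_def)

lemma zero_mor_in_Hom:
  assumes "crossed_module A" "crossed_module T"
  shows "zero_mor A T \<in> Hom A T"
proof -
  note A = crossed_moduleD[OF assms(1)] and T = crossed_moduleD[OF assms(2)]
  interpret A1: group "grp1 A" by (rule A)
  interpret A2: group "grp2 A" by (rule A)
  interpret T1: group "grp1 T" by (rule T)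
  interpret T2: group "grp2 T" by (rule T)
  have "bd T \<one>\<^bsub>grp1 T\<^esub> = \<one>\<^bsub>grp2 T\<^esub>"
    using hom_one[OF T(3) T(1,2)] .
  then show ?thesis
    using A(4,5) T(8) by (auto simp: Hom_iff zero_mor_def hom_def)
qed

lemma null_iff:
  assumes "crossed_module A" "crossed_module T"
  shows "null A T \<longleftrightarrow>
    (\<forall>g \<in> Hom A T. (\<forall>t \<in> carrier (grp1 A). fst g t = \<one>\<^bsub>grp1 T\<^esub>) \<and>
                   (\<forall>b \<in> carrier (grp2 A). snd g b = \<one>\<^bsub>grp2 T\<^esub>))"
  using zero_mor_in_Hom[OF assms] by (auto simp: null_def intro!: Hom_eqI)

lemma null_retract:
  assumes T: "crossed_module T" and A: "crossed_module A" and Z: "crossed_module Z"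
    and i: "i \<in> Hom T A" and p: "p \<in> Hom A T" and retract: "Comp T p i = Ident T"
    and null: "null A Z"
  shows "null T Z"
  unfolding null_iff[OF T Z]
proof
  fix g assume g: "g \<in> Hom T Z"
  have "g = Comp T (Comp A g p) i"
    using Comp_assoc[OF i, of g p] retract Comp_Ident_right[OF T g] by simp
  also have "Comp A g p = zero_mor A Z"
    using Comp_in_Hom[OF A p g] null by (simp add: null_def)
  finally have g_eq: "g = Comp T (zero_mor A Z) i" .
  show "(\<forall>t \<in> carrier (grp1 T). fst g t = \<one>\<^bsub>grp1 Z\<^esub>) \<and> (\<forall>b \<in> carrier (grp2 T). snd g b = \<one>\<^bsub>grp2 Z\<^esub>)"
    using Hom_closed[OF i] by (simp add: g_eq)
qed

lemma trivial_crossed_module: "crossed_module trivial_xmod"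
  by (rule crossed_moduleI)
    (auto simp: trivial_xmod_def singleton_group_def hom_def
      intro: groupI)

lemma trivial_carrier:
  "carrier (grp1 trivial_xmod) = {undefined}" "carrier (grp2 trivial_xmod) = {undefined}"
  by (simp_all add: trivial_xmod_def)

lemma null_trivial:
  assumes "crossed_module T"
  shows "null trivial_xmod T"
proof -
  have "fst g t = \<one>\<^bsub>grp1 T\<^esub>" "snd g b = \<one>\<^bsub>grp2 T\<^esub>"
    if g: "g \<in> Hom trivial_xmod T"
      and tb: "t \<in> carrier (grp1 trivial_xmod)" "b \<in> carrier (grp2 trivial_xmod)" for g t b
  proof -
    have one: "t = \<one>\<^bsub>grp1 trivial_xmod\<^esub>" "b = \<one>\<^bsub>grp2 trivial_xmod\<^esub>"
      using tb by (simp_all add: trivial_xmod_def singleton_group_def)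
    note h = Hom_group_hom[OF g trivial_crossed_module assms]
    show "fst g t = \<one>\<^bsub>grp1 T\<^esub>" unfolding one using group_hom.hom_one[OF h(1)] .
    show "snd g b = \<one>\<^bsub>grp2 T\<^esub>" unfolding one using group_hom.hom_one[OF h(2)] .
  qed
  then show ?thesis
    using null_iff[OF trivial_crossed_module assms]
    by (metis trivial_carrier singletonI)
qed

text \<open>
  There is exactly one morphism from \<open>1\<close> to \<open>T\<close>, and the zero morphism \<open>A \<rightarrow> T\<close> is its composite
  with \<open>A \<rightarrow> 1\<close>.
\<close>

lemma local_at_to_trivial_iff:
  assumes A: "crossed_module A" and T: "T \<in> XMod small"
  shows "local_xmod small A trivial_xmod (to_trivial A) T \<longleftrightarrow> null A T"
proof -
  have "fst (zero_mor trivial_xmod T) \<one>\<^bsub>grp1 trivial_xmod\<^esub> = \<one>\<^bsub>grp1 T\<^esub>"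
    "snd (zero_mor trivial_xmod T) \<one>\<^bsub>grp2 trivial_xmod\<^esub> = \<one>\<^bsub>grp2 T\<^esub>"
    by (simp_all add: trivial_xmod_def zero_mor_def singleton_group_def)
  then have comp: "Comp A (zero_mor trivial_xmod T) (to_trivial A) = zero_mor A T"
    by (auto simp: Comp_def compose_def to_trivial_def zero_mor_def[of A T] fun_eq_iff restrict_def)
  have "Hom trivial_xmod T = {zero_mor trivial_xmod T}"
    using null_trivial[OF XModD(1)[OF T]] by (simp add: null_def)
  then show ?thesis
    using T comp by (auto simp: local_xmod_def bij_betw_def null_def)
qed

section \<open>Kernels and regular epimorphisms\<close>

lemma ker_simps [simp]:
  "carrier (grp1 (ker T S e)) = kernel (grp1 T) (grp1 S) (fst e)"
  "carrier (grp2 (ker T S e)) = kernel (grp2 T) (grp2 S) (snd e)"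
  "mult (grp1 (ker T S e)) = mult (grp1 T)"
  "mult (grp2 (ker T S e)) = mult (grp2 T)"
  "one (grp1 (ker T S e)) = one (grp1 T)"
  "one (grp2 (ker T S e)) = one (grp2 T)"
  "bd (ker T S e) = bd T"
  "act (ker T S e) = (\<lambda>b. restrict (act T b) (kernel (grp1 T) (grp1 S) (fst e)))"
  by (simp_all add: ker_def)

text \<open>
  The kernel inherits the laws of the ambient crossed module, and it is closed under the
  connecting morphism and the action because the morphism commutes with both.
\<close>

lemma ker_crossed_module:
  assumes T: "crossed_module T" and S: "crossed_module S" and e: "e \<in> Hom T S"
  shows "crossed_module (ker T S e)"
proof -
  note h = Hom_group_hom[OF e T S] and TD = crossed_moduleD[OF T] and SD = crossed_moduleD[OF S]
  interpret h1: group_hom "grp1 T" "grp1 S" "fst e" by (rule h)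
  interpret h2: group_hom "grp2 T" "grp2 S" "snd e" by (rule h)
  let ?K = "ker T S e"
  have G1: "group (grp1 ?K)"
    using subgroup.subgroup_is_group[OF h1.subgroup_kernel h1.G.group_axioms]
    by (simp add: ker_def)
  have G2: "group (grp2 ?K)"
    using subgroup.subgroup_is_group[OF h2.subgroup_kernel h2.G.group_axioms]
    by (simp add: ker_def)
  have K: "t \<in> carrier (grp1 T)" if "t \<in> kernel (grp1 T) (grp1 S) (fst e)" for t
    using that by (simp add: kernel_def)
  have K2: "b \<in> carrier (grp2 T)" if "b \<in> kernel (grp2 T) (grp2 S) (snd e)" for b
    using that by (simp add: kernel_def)
  have bd: "bd T t \<in> kernel (grp2 T) (grp2 S) (snd e)"
    if "t \<in> kernel (grp1 T) (grp1 S) (fst e)" for t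
    using that e TD(4) hom_one[OF SD(3) SD(1,2)] by (simp add: kernel_def Hom_iff)
  have closed: "act T b t \<in> kernel (grp1 T) (grp1 S) (fst e)"
    if "b \<in> kernel (grp2 T) (grp2 S) (snd e)" "t \<in> kernel (grp1 T) (grp1 S) (fst e)" for b t
    using that e TD(5) SD(10) by (simp add: kernel_def Hom_iff)
  have inv1: "inv\<^bsub>grp1 ?K\<^esub> t = inv\<^bsub>grp1 T\<^esub> t"
    if "t \<in> kernel (grp1 T) (grp1 S) (fst e)" for t
    using h1.G.m_inv_consistent[OF h1.subgroup_kernel that] by (simp add: ker_def)
  have inv2: "inv\<^bsub>grp2 ?K\<^esub> b = inv\<^bsub>grp2 T\<^esub> b"
    if "b \<in> kernel (grp2 T) (grp2 S) (snd e)" for b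
    using h2.G.m_inv_consistent[OF h2.subgroup_kernel that] by (simp add: ker_def)
  note sub = subgroup.m_closed[OF h1.subgroup_kernel] subgroup.m_closed[OF h2.subgroup_kernel]
    subgroup.one_closed[OF h2.subgroup_kernel]
  show ?thesis
  proof (rule crossed_moduleI)
    show "bd ?K \<in> hom (grp1 ?K) (grp2 ?K)"
      using bd K hom_mult[OF TD(3)] by (auto intro!: homI)
  qed (use G1 G2 bd closed inv1 inv2 K K2 TD sub in auto)
qed

lemma ker_in_XMod:
  assumes "universe small" "T \<in> XMod small" "crossed_module S" "e \<in> Hom T S"
  shows "ker T S e \<in> XMod small"
proof -
  have "kernel (grp1 T) (grp1 S) (fst e) \<subseteq> carrier (grp1 T)"
    "kernel (grp2 T) (grp2 S) (snd e) \<subseteq> carrier (grp2 T)"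
    by (auto simp: kernel_def)
  then show ?thesis
    using assms ker_crossed_module[OF XModD(1)[OF assms(2)] assms(3,4)] XModD[OF assms(2)]
    unfolding XMod_def universe_def by (auto; blast)
qed

lemma ker_inclusion_in_Hom: "Ident (ker T S e) \<in> Hom (ker T S e) T"
  if "crossed_module T" "crossed_module S" "e \<in> Hom T S"
  using crossed_moduleD(1,2,4,5)[OF ker_crossed_module[OF that]] crossed_moduleD(4,5)[OF that(1)]
  by (auto simp: Hom_iff hom_def Ident_def group.is_monoid monoid.m_closed kernel_def
      dest: monoid.m_closed[OF group.is_monoid])

text \<open>
  The quotient of two elements with the same image under \<open>e\<close> lies in the kernel of \<open>e\<close>, where
  \<open>g\<close> vanishes.
\<close>

lemma group_hom_eq_if_trivial_on_kernel:
  assumes e: "group_hom G H e" and g: "group_hom G K g"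
    and ker: "\<And>x. x \<in> kernel G H e \<Longrightarrow> g x = \<one>\<^bsub>K\<^esub>"
    and xy: "x \<in> carrier G" "y \<in> carrier G" "e x = e y"
  shows "g x = g y"
proof -
  interpret e: group_hom G H e by (rule e)
  interpret g: group_hom G K g by (rule g)
  have "x \<otimes>\<^bsub>G\<^esub> inv\<^bsub>G\<^esub> y \<in> kernel G H e"
    using xy by (simp add: kernel_def)
  then have "g x \<otimes>\<^bsub>K\<^esub> inv\<^bsub>K\<^esub> (g y) = \<one>\<^bsub>K\<^esub>"
    using ker[of "x \<otimes>\<^bsub>G\<^esub> inv\<^bsub>G\<^esub> y"] xy by simp
  then have "g x \<otimes>\<^bsub>K\<^esub> inv\<^bsub>K\<^esub> (g y) = g y \<otimes>\<^bsub>K\<^esub> inv\<^bsub>K\<^esub> (g y)"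
    using xy by simp
  then show ?thesis
    using xy by (simp only: g.H.right_cancel g.hom_closed g.H.inv_closed)
qed

text \<open>
  If \<open>e\<close> is a coequalizer of \<open>p\<close> and \<open>q\<close>, the elementwise quotients of \<open>p\<close> and \<open>q\<close> lie in the
  kernel of \<open>e\<close>, so a morphism that vanishes there equalizes \<open>p\<close> and \<open>q\<close>.  With the uniqueness
  in the next lemma, \<open>e\<close> is thus a cokernel of its kernel.
\<close>

lemma regular_epi_factor:
  assumes e: "regular_epi small T S e"
    and T: "T \<in> XMod small" and S: "S \<in> XMod small" and Z: "Z \<in> XMod small"
    and g: "g \<in> Hom T Z" and null: "null (ker T S e) Z"
  obtains k where "k \<in> Hom S Z" "Comp T k e = g"
proof -
  note T' = XModD(1)[OF T] and S' = XModD(1)[OF S] and Z' = XModD(1)[OF Z]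
  from e obtain X p q where eH: "e \<in> Hom T S" and X: "X \<in> XMod small"
    and p: "p \<in> Hom X T" and q: "q \<in> Hom X T" and epq: "Comp X e p = Comp X e q"
    and coeq: "\<forall>Z \<in> XMod small. \<forall>g \<in> Hom T Z. Comp X g p = Comp X g q \<longrightarrow>
           (\<exists>!k. k \<in> Hom S Z \<and> Comp T k e = g)"
    unfolding regular_epi_def by blast
  note X' = XModD(1)[OF X]
  let ?K = "ker T S e"
  note K' = ker_crossed_module[OF T' S' eH]
  have "Comp ?K g (Ident ?K) \<in> Hom ?K Z"
    using Comp_in_Hom[OF K' ker_inclusion_in_Hom[OF T' S' eH] g] .
  then have "(\<forall>t \<in> carrier (grp1 ?K). fst (Comp ?K g (Ident ?K)) t = \<one>\<^bsub>grp1 Z\<^esub>) \<and>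
             (\<forall>b \<in> carrier (grp2 ?K). snd (Comp ?K g (Ident ?K)) b = \<one>\<^bsub>grp2 Z\<^esub>)"
    using null null_iff[OF K' Z'] by blast
  then have gK: "\<And>t. t \<in> carrier (grp1 ?K) \<Longrightarrow> fst g t = \<one>\<^bsub>grp1 Z\<^esub>"
    "\<And>b. b \<in> carrier (grp2 ?K) \<Longrightarrow> snd g b = \<one>\<^bsub>grp2 Z\<^esub>"
    by (auto simp del: ker_simps)
  have e1: "fst e (fst p x) = fst e (fst q x)" if "x \<in> carrier (grp1 X)" for x
    using arg_cong[OF epq, of "\<lambda>h. fst h x"] that by simp
  have e2: "snd e (snd p x) = snd e (snd q x)" if "x \<in> carrier (grp2 X)" for x
    using arg_cong[OF epq, of "\<lambda>h. snd h x"] that by simp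
  have "Comp X g p = Comp X g q"
  proof (rule Hom_eqI[OF Comp_in_Hom[OF X' p g] Comp_in_Hom[OF X' q g]])
    fix x assume x: "x \<in> carrier (grp1 X)"
    have "fst g (fst p x) = fst g (fst q x)"
      using group_hom_eq_if_trivial_on_kernel[OF Hom_group_hom(1)[OF eH T' S']
          Hom_group_hom(1)[OF g T' Z'] _ Hom_closed(1)[OF p x] Hom_closed(1)[OF q x] e1[OF x]]
        gK(1) by simp
    then show "fst (Comp X g p) x = fst (Comp X g q) x" using x by simp
  next
    fix x assume x: "x \<in> carrier (grp2 X)"
    have "snd g (snd p x) = snd g (snd q x)"
      using group_hom_eq_if_trivial_on_kernel[OF Hom_group_hom(2)[OF eH T' S']
          Hom_group_hom(2)[OF g T' Z'] _ Hom_closed(2)[OF p x] Hom_closed(2)[OF q x] e2[OF x]]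
        gK(2) by simp
    then show "snd (Comp X g p) x = snd (Comp X g q) x" using x by simp
  qed
  then show ?thesis using coeq Z g that by blast
qed

text \<open>
  This is the epimorphism property, kept within the universe: the coequalizer in the definition
  is tested on small crossed modules only.
\<close>

lemma regular_epi_cancel:
  assumes e: "regular_epi small T S e" and T: "crossed_module T" and Z: "Z \<in> XMod small"
    and k: "k \<in> Hom S Z" and k': "k' \<in> Hom S Z" and eq: "Comp T k e = Comp T k' e"
  shows "k = k'"
proof -
  from e obtain X p q where eH: "e \<in> Hom T S"
    and p: "p \<in> Hom X T" and q: "q \<in> Hom X T" and epq: "Comp X e p = Comp X e q"
    and coeq: "\<forall>Z \<in> XMod small. \<forall>g \<in> Hom T Z. Comp X g p = Comp X g q \<longrightarrow>
           (\<exists>!k. k \<in> Hom S Z \<and> Comp T k e = g)"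
    unfolding regular_epi_def by blast
  have "Comp X (Comp T k e) p = Comp X (Comp T k e) q"
    using epq by (simp add: Comp_assoc[OF p, symmetric] Comp_assoc[OF q, symmetric])
  then have "\<exists>!m. m \<in> Hom S Z \<and> Comp T m e = Comp T k e"
    using coeq Z Comp_in_Hom[OF T eH k] by blast
  then show ?thesis using k k' eq by metis
qed

section \<open>Binary products of small crossed modules\<close>

text \<open>
  The two sets and an infinite small set all embed in the largest of the three.  That set is
  small and infinite, hence equipotent with its square, into which the product embeds.
\<close>

lemma small_product_encoding:
  includes cardinal_syntax
  fixes small :: "'u set \<Rightarrow> bool"
  assumes u: "universe small" and Y: "small Y" and Z: "small Z"
  obtains h :: "'u \<times> 'u \<Rightarrow> 'u" where "inj_on h (Y \<times> Z)" "small (h ` (Y \<times> Z))"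
proof -
  have small_sub: "small V" if "small W" "V \<subseteq> W" for V W
    using u that unfolding universe_def by metis
  obtain X where X: "small X" "infinite X"
    using u unfolding universe_def by metis
  obtain W where W: "small W" "infinite W" "|Y| \<le>o |W|" "|Z| \<le>o |W|"
  proof -
    have larger: "\<exists>W. (W = V \<or> W = V') \<and> |V| \<le>o |W| \<and> |V'| \<le>o |W|" for V V' :: "'u set"
      using ordLeq_total[OF card_of_Well_order card_of_Well_order, of V V']
        ordLeq_reflexive[OF card_of_Well_order, of V] ordLeq_reflexive[OF card_of_Well_order, of V']
      by metis
    obtain V where V: "V = X \<or> V = Y" "|X| \<le>o |V|" "|Y| \<le>o |V|"
      using larger[of X Y] by auto
    obtain W where W: "W = V \<or> W = Z" "|V| \<le>o |W|" "|Z| \<le>o |W|"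
      using larger[of V Z] by auto
    have YW: "|Y| \<le>o |W|" using V(3) W(2) by (rule ordLeq_transitive)
    have "|X| \<le>o |W|" using V(2) W(2) by (rule ordLeq_transitive)
    then have "infinite W" using card_of_ordLeq_finite[of X W] X(2) by auto
    moreover have "small W" using V(1) W(1) X(1) Y Z by auto
    ultimately show ?thesis using that W(3) YW by auto
  qed
  have "|Y \<times> Z| \<le>o |W \<times> W|"
    using card_of_Times_mono1[OF W(3), of Z] card_of_Times_mono2[OF W(4), of W]
    by (rule ordLeq_transitive)
  then have "|Y \<times> Z| \<le>o |W|"
    using card_of_Times_same_infinite[OF W(2)] by (rule ordLeq_ordIso_trans)
  then obtain h where h: "inj_on h (Y \<times> Z)" "h ` (Y \<times> Z) \<subseteq> W"
    unfolding card_of_ordLeq[symmetric] by auto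
  show ?thesis using that[OF h(1)] small_sub[OF W(1) h(2)] .
qed

lemma image_group_of_inj:
  assumes G: "group G" and h: "inj_on h (carrier G)"
  shows "group_hom G (image_group h G) h"
proof -
  interpret group G by (rule G)
  have "h a = h b \<longleftrightarrow> a \<otimes>\<^bsub>G\<^esub> inv\<^bsub>G\<^esub> b \<in> {\<one>\<^bsub>G\<^esub>}"
    if "a \<in> carrier G" "b \<in> carrier G" for a b
    using that inv_solve_right'[of "\<one>\<^bsub>G\<^esub>" a b] inj_on_eq_iff[OF h that] by simp
  then have "weak_group_morphism h {\<one>\<^bsub>G\<^esub>} G"
    by (intro weak_group_morphismsI one_is_normal)
  then show ?thesis by (rule weak_group_morphism_group_hom)
qed
text \<open>
  The product is carried by codes of pairs, since its elements must have the type of those of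
  its factors.
\<close>

locale encoded_product =
  fixes T S :: "'u xmod" and h1 h2 :: "'u \<times> 'u \<Rightarrow> 'u"
  assumes T: "crossed_module T" and S: "crossed_module S"
    and inj1: "inj_on h1 (carrier (grp1 T) \<times> carrier (grp1 S))"
    and inj2: "inj_on h2 (carrier (grp2 T) \<times> carrier (grp2 S))"
begin

definition P :: "'u xmod" where
  "P = \<lparr>grp1 = image_group h1 (grp1 T \<times>\<times> grp1 S),
        grp2 = image_group h2 (grp2 T \<times>\<times> grp2 S),
        bd = (\<lambda>x. case inv_into (carrier (grp1 T) \<times> carrier (grp1 S)) h1 x of
               (t, s) \<Rightarrow> h2 (bd T t, bd S s)),
        act = (\<lambda>y. \<lambda>x \<in> h1 ` (carrier (grp1 T) \<times> carrier (grp1 S)).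
          case (inv_into (carrier (grp2 T) \<times> carrier (grp2 S)) h2 y,
                inv_into (carrier (grp1 T) \<times> carrier (grp1 S)) h1 x) of
            ((b, c), (t, s)) \<Rightarrow> h1 (act T b t, act S c s))\<rparr>"

lemma carrier_P [simp]:
  "carrier (grp1 P) = h1 ` (carrier (grp1 T) \<times> carrier (grp1 S))"
  "carrier (grp2 P) = h2 ` (carrier (grp2 T) \<times> carrier (grp2 S))"
  by (simp_all add: P_def image_group_carrier)

lemma one_P:
  "\<one>\<^bsub>grp1 P\<^esub> = h1 (\<one>\<^bsub>grp1 T\<^esub>, \<one>\<^bsub>grp1 S\<^esub>)"
  "\<one>\<^bsub>grp2 P\<^esub> = h2 (\<one>\<^bsub>grp2 T\<^esub>, \<one>\<^bsub>grp2 S\<^esub>)"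
  by (simp_all add: P_def image_group_one one_DirProd)

lemma bd_P:
  assumes "t \<in> carrier (grp1 T)" "s \<in> carrier (grp1 S)"
  shows "bd P (h1 (t, s)) = h2 (bd T t, bd S s)"
  using assms inj1 by (simp add: P_def)

lemma act_P:
  assumes "t \<in> carrier (grp1 T)" "s \<in> carrier (grp1 S)"
    and "b \<in> carrier (grp2 T)" "c \<in> carrier (grp2 S)"
  shows "act P (h2 (b, c)) (h1 (t, s)) = h1 (act T b t, act S c s)"
  using assms inj1 inj2 by (simp add: P_def)

lemma hom_h:
  "group_hom (grp1 T \<times>\<times> grp1 S) (grp1 P) h1"
  "group_hom (grp2 T \<times>\<times> grp2 S) (grp2 P) h2"
  using image_group_of_inj[OF DirProd_group[OF crossed_moduleD(1)[OF T] crossed_moduleD(1)[OF S]]]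
    image_group_of_inj[OF DirProd_group[OF crossed_moduleD(2)[OF T] crossed_moduleD(2)[OF S]]]
    inj1 inj2 by (simp_all add: P_def)

lemma mult_P:
  "t \<in> carrier (grp1 T) \<Longrightarrow> s \<in> carrier (grp1 S) \<Longrightarrow> t' \<in> carrier (grp1 T) \<Longrightarrow>
     s' \<in> carrier (grp1 S) \<Longrightarrow>
     h1 (t, s) \<otimes>\<^bsub>grp1 P\<^esub> h1 (t', s') = h1 (t \<otimes>\<^bsub>grp1 T\<^esub> t', s \<otimes>\<^bsub>grp1 S\<^esub> s')"
  "b \<in> carrier (grp2 T) \<Longrightarrow> c \<in> carrier (grp2 S) \<Longrightarrow> b' \<in> carrier (grp2 T) \<Longrightarrow>
     c' \<in> carrier (grp2 S) \<Longrightarrow>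
     h2 (b, c) \<otimes>\<^bsub>grp2 P\<^esub> h2 (b', c') = h2 (b \<otimes>\<^bsub>grp2 T\<^esub> b', c \<otimes>\<^bsub>grp2 S\<^esub> c')"
  using group_hom.hom_mult[OF hom_h(1), of "(t, s)" "(t', s')"]
    group_hom.hom_mult[OF hom_h(2), of "(b, c)" "(b', c')"] by simp_all

lemma inv_P:
  "t \<in> carrier (grp1 T) \<Longrightarrow> s \<in> carrier (grp1 S) \<Longrightarrow>
     inv\<^bsub>grp1 P\<^esub> (h1 (t, s)) = h1 (inv\<^bsub>grp1 T\<^esub> t, inv\<^bsub>grp1 S\<^esub> s)"
  "b \<in> carrier (grp2 T) \<Longrightarrow> c \<in> carrier (grp2 S) \<Longrightarrow>
     inv\<^bsub>grp2 P\<^esub> (h2 (b, c)) = h2 (inv\<^bsub>grp2 T\<^esub> b, inv\<^bsub>grp2 S\<^esub> c)"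
  using group_hom.hom_inv[OF hom_h(1), of "(t, s)"] group_hom.hom_inv[OF hom_h(2), of "(b, c)"]
    inv_DirProd[OF crossed_moduleD(1)[OF T] crossed_moduleD(1)[OF S], of t s]
    inv_DirProd[OF crossed_moduleD(2)[OF T] crossed_moduleD(2)[OF S], of b c] by simp_all

lemma crossed_module_P: "crossed_module P"
proof -
  note TD = crossed_moduleD[OF T] and SD = crossed_moduleD[OF S]
  interpret T1: group "grp1 T" by (rule TD)
  interpret T2: group "grp2 T" by (rule TD)
  interpret S1: group "grp1 S" by (rule SD)
  interpret S2: group "grp2 S" by (rule SD)
  note laws = bd_P act_P mult_P inv_P one_P TD(4,5,7-12) SD(4,5,7-12)
    hom_mult[OF TD(3)] hom_mult[OF SD(3)]
  show ?thesis
  proof (rule crossed_moduleI)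
    show "group (grp1 P)" "group (grp2 P)"
      using hom_h by (simp_all add: group_hom_def)
    show "act P b \<in> extensional (carrier (grp1 P))" for b
      by (simp add: P_def image_group_carrier)
    show "bd P \<in> hom (grp1 P) (grp2 P)"
      by (rule homI) (auto simp: laws)
  qed (auto simp: laws)
qed

lemma injections_in_Hom:
  "(\<lambda>t \<in> carrier (grp1 T). h1 (t, \<one>\<^bsub>grp1 S\<^esub>), \<lambda>b \<in> carrier (grp2 T). h2 (b, \<one>\<^bsub>grp2 S\<^esub>))
     \<in> Hom T P"
  "(\<lambda>s \<in> carrier (grp1 S). h1 (\<one>\<^bsub>grp1 T\<^esub>, s), \<lambda>c \<in> carrier (grp2 S). h2 (\<one>\<^bsub>grp2 T\<^esub>, c))
     \<in> Hom S P"
proof -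
  note TD = crossed_moduleD[OF T] and SD = crossed_moduleD[OF S]
  interpret T1: group "grp1 T" by (rule TD)
  interpret T2: group "grp2 T" by (rule TD)
  interpret S1: group "grp1 S" by (rule SD)
  interpret S2: group "grp2 S" by (rule SD)
  note laws = bd_P act_P mult_P TD(4,5,8) SD(4,5,8)
    hom_one[OF TD(3) TD(1,2)] hom_one[OF SD(3) SD(1,2)]
  show "(\<lambda>t \<in> carrier (grp1 T). h1 (t, \<one>\<^bsub>grp1 S\<^esub>), \<lambda>b \<in> carrier (grp2 T). h2 (b, \<one>\<^bsub>grp2 S\<^esub>))
     \<in> Hom T P"
    by (auto simp: Hom_iff laws intro!: homI)
  show "(\<lambda>s \<in> carrier (grp1 S). h1 (\<one>\<^bsub>grp1 T\<^esub>, s), \<lambda>c \<in> carrier (grp2 S). h2 (\<one>\<^bsub>grp2 T\<^esub>, c))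
     \<in> Hom S P"
    by (auto simp: Hom_iff laws intro!: homI)
qed

lemma projections_in_Hom:
  "(\<lambda>x \<in> carrier (grp1 P). fst (inv_into (carrier (grp1 T) \<times> carrier (grp1 S)) h1 x),
    \<lambda>y \<in> carrier (grp2 P). fst (inv_into (carrier (grp2 T) \<times> carrier (grp2 S)) h2 y)) \<in> Hom P T"
  "(\<lambda>x \<in> carrier (grp1 P). snd (inv_into (carrier (grp1 T) \<times> carrier (grp1 S)) h1 x),
    \<lambda>y \<in> carrier (grp2 P). snd (inv_into (carrier (grp2 T) \<times> carrier (grp2 S)) h2 y)) \<in> Hom P S"
proof -
  note TD = crossed_moduleD[OF T] and SD = crossed_moduleD[OF S]
  interpret T1: group "grp1 T" by (rule TD)
  interpret T2: group "grp2 T" by (rule TD)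
  interpret S1: group "grp1 S" by (rule SD)
  interpret S2: group "grp2 S" by (rule SD)
  note laws = bd_P act_P mult_P TD(4,5) SD(4,5) inj1 inj2 inj_on_eq_iff[OF inj1] inj_on_eq_iff[OF inj2]
  show "(\<lambda>x \<in> carrier (grp1 P). fst (inv_into (carrier (grp1 T) \<times> carrier (grp1 S)) h1 x),
    \<lambda>y \<in> carrier (grp2 P). fst (inv_into (carrier (grp2 T) \<times> carrier (grp2 S)) h2 y)) \<in> Hom P T"
    by (auto simp: Hom_iff laws intro!: homI)
  show "(\<lambda>x \<in> carrier (grp1 P). snd (inv_into (carrier (grp1 T) \<times> carrier (grp1 S)) h1 x),
    \<lambda>y \<in> carrier (grp2 P). snd (inv_into (carrier (grp2 T) \<times> carrier (grp2 S)) h2 y)) \<in> Hom P S"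
    by (auto simp: Hom_iff laws intro!: homI)
qed

text \<open>
  The factors are retracts of the product, so a nonzero morphism out of a factor extends to one
  out of the product; and they generate the product, so a morphism that vanishes on both is zero.
\<close>

lemma null_P_iff:
  assumes Z: "crossed_module Z"
  shows "null P Z \<longleftrightarrow> null T Z \<and> null S Z"
proof -
  note TD = crossed_moduleD[OF T] and SD = crossed_moduleD[OF S]
  interpret T1: group "grp1 T" by (rule TD)
  interpret T2: group "grp2 T" by (rule TD)
  interpret S1: group "grp1 S" by (rule SD)
  interpret S2: group "grp2 S" by (rule SD)
  note null_T = null_iff[OF T Z] and null_S = null_iff[OF S Z]
  have "null T Z \<and> null S Z" if P: "null P Z"
  proof
    show "null T Z"
      by (rule null_retract[OF T crossed_module_P Z injections_in_Hom(1) projections_in_Hom(1) _ P])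
        (use inj1 inj2 in \<open>auto simp: Comp_def compose_def Ident_def fun_eq_iff restrict_def\<close>)
    show "null S Z"
      by (rule null_retract[OF S crossed_module_P Z injections_in_Hom(2) projections_in_Hom(2) _ P])
        (use inj1 inj2 in \<open>auto simp: Comp_def compose_def Ident_def fun_eq_iff restrict_def\<close>)
  qed
  moreover have "null P Z" if nT: "null T Z" and nS: "null S Z"
  proof -
    have zero: "fst g (h1 (t, s)) = \<one>\<^bsub>grp1 Z\<^esub>" "snd g (h2 (b, c)) = \<one>\<^bsub>grp2 Z\<^esub>"
      if g: "g \<in> Hom P Z"
        and ts: "t \<in> carrier (grp1 T)" "s \<in> carrier (grp1 S)"
        and bc: "b \<in> carrier (grp2 T)" "c \<in> carrier (grp2 S)"
      for g t s b c
    proof -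
      note gh = Hom_group_hom[OF g crossed_module_P Z]
      note iT = nT[unfolded null_T, rule_format, OF Comp_in_Hom[OF T injections_in_Hom(1) g]]
        and iS = nS[unfolded null_S, rule_format, OF Comp_in_Hom[OF S injections_in_Hom(2) g]]
      have z1: "fst g (h1 (t, \<one>\<^bsub>grp1 S\<^esub>)) = \<one>\<^bsub>grp1 Z\<^esub>" "fst g (h1 (\<one>\<^bsub>grp1 T\<^esub>, s)) = \<one>\<^bsub>grp1 Z\<^esub>"
        and z2: "snd g (h2 (b, \<one>\<^bsub>grp2 S\<^esub>)) = \<one>\<^bsub>grp2 Z\<^esub>" "snd g (h2 (\<one>\<^bsub>grp2 T\<^esub>, c)) = \<one>\<^bsub>grp2 Z\<^esub>"
        using iT iS ts bc by auto
      have eq: "h1 (t, s) = h1 (t, \<one>\<^bsub>grp1 S\<^esub>) \<otimes>\<^bsub>grp1 P\<^esub> h1 (\<one>\<^bsub>grp1 T\<^esub>, s)"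
        "h2 (b, c) = h2 (b, \<one>\<^bsub>grp2 S\<^esub>) \<otimes>\<^bsub>grp2 P\<^esub> h2 (\<one>\<^bsub>grp2 T\<^esub>, c)"
        using ts bc by (simp_all add: mult_P)
      have one: "\<one>\<^bsub>grp1 Z\<^esub> \<otimes>\<^bsub>grp1 Z\<^esub> \<one>\<^bsub>grp1 Z\<^esub> = \<one>\<^bsub>grp1 Z\<^esub>" "\<one>\<^bsub>grp2 Z\<^esub> \<otimes>\<^bsub>grp2 Z\<^esub> \<one>\<^bsub>grp2 Z\<^esub> = \<one>\<^bsub>grp2 Z\<^esub>"
        using group_hom.axioms(2)[OF gh(1)] group_hom.axioms(2)[OF gh(2)]
        by (simp_all add: group.is_monoid monoid.l_one monoid.one_closed)
      show "fst g (h1 (t, s)) = \<one>\<^bsub>grp1 Z\<^esub>"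
        unfolding eq(1) using ts z1 one by (subst group_hom.hom_mult[OF gh(1)]) auto
      show "snd g (h2 (b, c)) = \<one>\<^bsub>grp2 Z\<^esub>"
        unfolding eq(2) using bc z2 one by (subst group_hom.hom_mult[OF gh(2)]) auto
    qed
    show ?thesis
      unfolding null_iff[OF crossed_module_P Z]
      using zero[OF _ _ _ T2.one_closed S2.one_closed] zero[OF _ T1.one_closed S1.one_closed]
      by auto
  qed
  ultimately show ?thesis by blast
qed

end

lemma null_product_exists:
  assumes u: "universe small" and T: "T \<in> XMod small" and S: "S \<in> XMod small"
  obtains A where "A \<in> XMod small"
    and "\<And>Z. crossed_module Z \<Longrightarrow> null A Z \<longleftrightarrow> null T Z \<and> null S Z"
proof -
  note T' = XModD[OF T] and S' = XModD[OF S]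
  obtain h1 where h1: "inj_on h1 (carrier (grp1 T) \<times> carrier (grp1 S))"
    "small (h1 ` (carrier (grp1 T) \<times> carrier (grp1 S)))"
    using small_product_encoding[OF u T'(2) S'(2)] .
  obtain h2 where h2: "inj_on h2 (carrier (grp2 T) \<times> carrier (grp2 S))"
    "small (h2 ` (carrier (grp2 T) \<times> carrier (grp2 S)))"
    using small_product_encoding[OF u T'(3) S'(3)] .
  interpret encoded_product T S h1 h2
    using T' S' h1 h2 by unfold_locales auto
  have "P \<in> XMod small"
    using crossed_module_P h1 h2 by (simp add: XMod_def)
  then show ?thesis using that null_P_iff by blast
qed
section \<open>Localizations and their local objects\<close>

lemma local_lift:
  assumes L: "is_localization_at small B C f L"
    and X: "X \<in> XMod small" and Z: "local_xmod small B C f Z" and g: "g \<in> Hom X Z"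
  obtains k where "k \<in> Hom (Obj L X) Z" "Comp X k (coaug L X) = g"
proof -
  have "bij_betw (\<lambda>k. Comp X k (coaug L X)) (Hom (Obj L X) Z) (Hom X Z)"
    using L X Z unfolding is_localization_at_def local_equivalence_def by blast
  then have "g \<in> (\<lambda>k. Comp X k (coaug L X)) ` Hom (Obj L X) Z"
    using g by (simp add: bij_betw_def)
  then show ?thesis using that by auto
qed

lemma local_lift_unique:
  assumes L: "is_localization_at small B C f L"
    and X: "X \<in> XMod small" and Z: "local_xmod small B C f Z"
    and k: "k \<in> Hom (Obj L X) Z" and k': "k' \<in> Hom (Obj L X) Z"
    and eq: "Comp X k (coaug L X) = Comp X k' (coaug L X)"
  shows "k = k'"
proof -
  have "bij_betw (\<lambda>k. Comp X k (coaug L X)) (Hom (Obj L X) Z) (Hom X Z)"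
    using L X Z unfolding is_localization_at_def local_equivalence_def by blast
  then show ?thesis
    using inj_onD[OF bij_betw_imp_inj_on eq k k'] by simp
qed

lemma localizationD:
  assumes "is_localization_at small B C f L" "T \<in> XMod small"
  shows "Obj L T \<in> XMod small" "crossed_module (Obj L T)"
    and "local_xmod small B C f (Obj L T)" "coaug L T \<in> Hom T (Obj L T)"
  using assms
  by (auto simp: is_localization_at_def local_xmod_def local_equivalence_def XMod_def)

lemma coaug_natural:
  assumes "is_localization_at small B C f L" "T \<in> XMod small" "S \<in> XMod small" "u \<in> Hom T S"
  shows "Mor L T S u \<in> Hom (Obj L T) (Obj L S)"
    and "Comp T (Mor L T S u) (coaug L T) = Comp T (coaug L S) u"
  using assms
  unfolding is_localization_at_def localization_functor_def coaugmented_functor_def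
    endofunctor_def by auto

text \<open>
  The equivalences, and with them the universal property of the coaugmentation, depend on the
  localized morphism only through the class of local objects.
\<close>

lemma is_localization_at_cong:
  assumes "\<And>T. local_xmod small B C f T \<longleftrightarrow> local_xmod small B' C' f' T"
  shows "is_localization_at small B C f L \<longleftrightarrow> is_localization_at small B' C' f' L"
  using assms by (simp add: is_localization_at_def local_equivalence_def)

lemma localization_unique:
  fixes L P :: "'u coaugmented"
  assumes L: "is_localization_at small B C f L" and P: "is_localization_at small B C f P"
  shows "coaugmented_iso small L P"
proof -
  define is_comparison where "is_comparison M N T h \<longleftrightarrow>
      h \<in> Hom (Obj M T) (Obj N T) \<and> Comp T h (coaug M T) = coaug N T"
    for M N :: "'u coaugmented" and T :: "'u xmod" and h :: "'u xmor"
  have ex: "\<exists>h. is_comparison M N T h"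
    if "is_localization_at small B C f M" "is_localization_at small B C f N" "T \<in> XMod small"
    for M N T
    using local_lift[OF that(1,3) localizationD(3,4)[OF that(2,3)]]
    unfolding is_comparison_def by blast
  have inverse: "Comp (Obj M T) h' h = Ident (Obj M T)"
    if M: "is_localization_at small B C f M" and N: "is_localization_at small B C f N"
      and T: "T \<in> XMod small" and h: "is_comparison M N T h" and h': "is_comparison N M T h'"
    for M N T h h'
  proof (rule local_lift_unique[OF M T localizationD(3)[OF M T]])
    note MT = localizationD[OF M T] and NT = localizationD[OF N T]
    show "Comp (Obj M T) h' h \<in> Hom (Obj M T) (Obj M T)"
      using Comp_in_Hom[OF MT(2)] h h' unfolding is_comparison_def by blast
    show "Ident (Obj M T) \<in> Hom (Obj M T) (Obj M T)"
      using Ident_in_Hom[OF MT(2)] .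
    show "Comp T (Comp (Obj M T) h' h) (coaug M T) = Comp T (Ident (Obj M T)) (coaug M T)"
      using h h' Comp_Ident_left[OF XModD(1)[OF T] MT(2,4)]
      by (simp add: is_comparison_def Comp_assoc[OF MT(4), symmetric])
  qed
  define \<theta> where "\<theta> T = (SOME h. is_comparison L P T h)" for T
  have \<theta>: "is_comparison L P T (\<theta> T)" if "T \<in> XMod small" for T
    using someI_ex[OF ex[OF L P that]] by (simp add: \<theta>_def)
  then have \<theta>_Hom: "\<And>T. T \<in> XMod small \<Longrightarrow> \<theta> T \<in> Hom (Obj L T) (Obj P T)"
    and \<theta>_coaug: "\<And>T. T \<in> XMod small \<Longrightarrow> Comp T (\<theta> T) (coaug L T) = coaug P T"
    by (auto simp: is_comparison_def)
  have "iso_mor (Obj L T) (Obj P T) (\<theta> T)" if T: "T \<in> XMod small" for T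
  proof -
    obtain h where h: "is_comparison P L T h" using ex[OF P L T] by blast
    then have "h \<in> Hom (Obj P T) (Obj L T)" by (simp add: is_comparison_def)
    then show ?thesis
      using \<theta>_Hom[OF T] inverse[OF L P T \<theta>[OF T] h] inverse[OF P L T h \<theta>[OF T]]
      by (auto simp: iso_mor_def)
  qed
  moreover have "Comp (Obj L T) (\<theta> S) (Mor L T S u) = Comp (Obj L T) (Mor P T S u) (\<theta> T)"
    if T: "T \<in> XMod small" and S: "S \<in> XMod small" and u: "u \<in> Hom T S" for T S u
  proof (rule local_lift_unique[OF L T localizationD(3)[OF P S]])
    note LT = localizationD[OF L T] and PT = localizationD[OF P T]
    note Lu = coaug_natural[OF L T S u] and Pu = coaug_natural[OF P T S u]
    show "Comp (Obj L T) (\<theta> S) (Mor L T S u) \<in> Hom (Obj L T) (Obj P S)"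
      using Comp_in_Hom[OF LT(2) Lu(1) \<theta>_Hom[OF S]] .
    show "Comp (Obj L T) (Mor P T S u) (\<theta> T) \<in> Hom (Obj L T) (Obj P S)"
      using Comp_in_Hom[OF LT(2) \<theta>_Hom[OF T] Pu(1)] .
    have "Comp T (Comp (Obj L T) (\<theta> S) (Mor L T S u)) (coaug L T)
        = Comp T (\<theta> S) (Comp T (coaug L S) u)"
      using Lu(2) by (simp add: Comp_assoc[OF LT(4), symmetric])
    also have "\<dots> = Comp T (coaug P S) u"
      using \<theta>_coaug[OF S] by (simp add: Comp_assoc[OF u])
    also have "\<dots> = Comp T (Comp (Obj L T) (Mor P T S u) (\<theta> T)) (coaug L T)"
      using Pu(2) \<theta>_coaug[OF T] by (simp add: Comp_assoc[OF LT(4), symmetric])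
    finally show "Comp T (Comp (Obj L T) (\<theta> S) (Mor L T S u)) (coaug L T)
        = Comp T (Comp (Obj L T) (Mor P T S u) (\<theta> T)) (coaug L T)" .
  qed
  ultimately show ?thesis
    using \<theta>_coaug unfolding coaugmented_iso_def by blast
qed

lemma null_if_isomorphic_trivial:
  assumes X: "crossed_module X" and Z: "crossed_module Z" and iso: "isomorphic X trivial_xmod"
  shows "null X Z"
proof -
  obtain i j where "i \<in> Hom X trivial_xmod" "j \<in> Hom trivial_xmod X" "Comp X j i = Ident X"
    using iso unfolding isomorphic_def iso_mor_def by blast
  then show ?thesis
    using null_retract[OF X trivial_crossed_module Z _ _ _ null_trivial[OF Z]] by blast
qed

text \<open>
  A morphism from an acyclic \<open>X\<close> to a local object factors through \<open>L X\<close>, which is trivial.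
\<close>

lemma acyclic_null_local:
  assumes L: "is_localization_at small B C f L" and X: "X \<in> XMod small"
    and acyclic: "acyclic_xmod L X" and Z: "local_xmod small B C f Z"
  shows "null X Z"
proof -
  have Z': "crossed_module Z" using Z by (simp add: local_xmod_def XMod_def)
  note X' = XModD(1)[OF X] and LX = localizationD[OF L X]
  have null: "null (Obj L X) Z"
    using null_if_isomorphic_trivial[OF LX(2) Z'] acyclic by (simp add: acyclic_xmod_def)
  show ?thesis
    unfolding null_iff[OF X' Z']
  proof
    fix g assume "g \<in> Hom X Z"
    then obtain k where k: "k \<in> Hom (Obj L X) Z" "Comp X k (coaug L X) = g"
      by (rule local_lift[OF L X Z])
    have "k = zero_mor (Obj L X) Z" using k(1) null by (simp add: null_def)
    then show "(\<forall>t \<in> carrier (grp1 X). fst g t = \<one>\<^bsub>grp1 Z\<^esub>) \<and>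
        (\<forall>b \<in> carrier (grp2 X). snd g b = \<one>\<^bsub>grp2 Z\<^esub>)"
      using k(2)[symmetric] Hom_closed[OF LX(4)] by simp
  qed
qed

text \<open>
  Every morphism from \<open>B\<close> or \<open>C\<close> to \<open>Z\<close> factors through the localization, and \<open>L f\<close> is
  invertible.  The inverse enters through its composite \<open>s\<close> with the coaugmentation of \<open>C\<close>,
  which the locality of \<open>L B\<close> supplies directly as the extension of the coaugmentation of \<open>B\<close>
  along \<open>f\<close>.
\<close>

lemma local_if_null_kernels:
  assumes L: "is_localization_at small B C f L" and R: "regular_epi_localization small L"
    and B: "B \<in> XMod small" and C: "C \<in> XMod small" and f: "f \<in> Hom B C"
    and Z: "Z \<in> XMod small"
    and nB: "null (ker B (Obj L B) (coaug L B)) Z" and nC: "null (ker C (Obj L C) (coaug L C)) Z"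
  shows "local_xmod small B C f Z"
proof -
  note B' = XModD(1)[OF B] and C' = XModD(1)[OF C]
  note LB = localizationD[OF L B] and LC = localizationD[OF L C]
  note Lf = coaug_natural[OF L B C f]
  have eB: "regular_epi small B (Obj L B) (coaug L B)"
    and eC: "regular_epi small C (Obj L C) (coaug L C)"
    using R B C by (auto simp: regular_epi_localization_def)
  have "coaug L B \<in> (\<lambda>g. Comp B g f) ` Hom C (Obj L B)"
    using LB(3,4) by (simp add: local_xmod_def bij_betw_def)
  then obtain s where s: "s \<in> Hom C (Obj L B)" "Comp B s f = coaug L B" by auto
  have Lf_s: "Comp C (Mor L B C f) s = coaug L C"
  proof -
    have "inj_on (\<lambda>g. Comp B g f) (Hom C (Obj L C))"
      using LC(3) by (simp add: local_xmod_def bij_betw_def)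
    moreover have "Comp B (Comp C (Mor L B C f) s) f = Comp B (coaug L C) f"
      using s(2) Lf(2) by (simp add: Comp_assoc[OF f, symmetric])
    ultimately show ?thesis
      using Comp_in_Hom[OF C' s(1) Lf(1)] LC(4) by (rule inj_onD)
  qed
  have "inj_on (\<lambda>g. Comp B g f) (Hom C Z)"
  proof (rule inj_onI)
    fix g g' assume g: "g \<in> Hom C Z" and g': "g' \<in> Hom C Z" and eq: "Comp B g f = Comp B g' f"
    obtain k where k: "k \<in> Hom (Obj L C) Z" "Comp C k (coaug L C) = g"
      using regular_epi_factor[OF eC C LC(1) Z g nC] .
    obtain k' where k': "k' \<in> Hom (Obj L C) Z" "Comp C k' (coaug L C) = g'"
      using regular_epi_factor[OF eC C LC(1) Z g' nC] .
    \<comment> \<open>\<open>g\<close> and \<open>g'\<close> agree after \<open>f\<close>, so their factors agree after \<open>L f\<close> since the coaugmentation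
      of \<open>B\<close> is epi; composing with \<open>s\<close> then undoes \<open>L f\<close>.\<close>
    have through_B: "Comp B (Comp (Obj L B) h (Mor L B C f)) (coaug L B)
        = Comp B (Comp C h (coaug L C)) f" for h
      using Lf(2) by (simp add: Comp_assoc[OF f, symmetric] Comp_assoc[OF LB(4), symmetric])
    have kk': "Comp (Obj L B) k (Mor L B C f) = Comp (Obj L B) k' (Mor L B C f)"
      using regular_epi_cancel[OF eB B' Z Comp_in_Hom[OF LB(2) Lf(1) k(1)]
          Comp_in_Hom[OF LB(2) Lf(1) k'(1)]] eq by (simp add: through_B k(2) k'(2))
    have through_C: "Comp C h (coaug L C) = Comp C (Comp (Obj L B) h (Mor L B C f)) s" for h
      using Lf_s by (simp add: Comp_assoc[OF s(1), symmetric])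
    show "g = g'"
      using k(2) k'(2) kk' by (simp add: through_C)
  qed
  moreover have "(\<lambda>g. Comp B g f) ` Hom C Z = Hom B Z"
  proof
    show "(\<lambda>g. Comp B g f) ` Hom C Z \<subseteq> Hom B Z"
      using Comp_in_Hom[OF B' f] by auto
    show "Hom B Z \<subseteq> (\<lambda>g. Comp B g f) ` Hom C Z"
    proof
      fix g assume "g \<in> Hom B Z"
      then obtain k where k: "k \<in> Hom (Obj L B) Z" "Comp B k (coaug L B) = g"
        using regular_epi_factor[OF eB B LB(1) Z _ nB] by blast
      have "g = Comp B (Comp C k s) f"
        using k(2) s(2) by (simp add: Comp_assoc[OF f, symmetric])
      then show "g \<in> (\<lambda>g. Comp B g f) ` Hom C Z"
        using Comp_in_Hom[OF C' s(1) k(1)] by blast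
    qed
  qed
  ultimately show ?thesis
    using Z by (simp add: local_xmod_def bij_betw_def)
qed

section \<open>The product of two kernels as nullifying object\<close>

theorem proposition4p3:
  fixes small :: "'u set \<Rightarrow> bool"
    and B C :: "'u xmod"
    and f :: "'u xmor"
    and L :: "'u coaugmented"
  assumes "universe small"
    and "B \<in> XMod small" and "C \<in> XMod small" and "f \<in> Hom B C"
    and "is_localization_at small B C f L"
    and "regular_epi_localization small L"
    and "\<And>T. T \<in> XMod small \<Longrightarrow> acyclic_xmod L (ker T (Obj L T) (coaug L T))"
  shows "\<exists>A \<in> XMod small.
           (\<exists>P. is_nullification small A P) \<and>
           (\<forall>P. is_nullification small A P \<longrightarrow> coaugmented_iso small L P)"
proof -
  note u = assms(1) and B = assms(2) and C = assms(3) and L = assms(5)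
  define K where "K T = ker T (Obj L T) (coaug L T)" for T
  have K: "K T \<in> XMod small" if "T \<in> XMod small" for T
    using ker_in_XMod[OF u that localizationD(2,4)[OF L that]] by (simp add: K_def)
  obtain A where A: "A \<in> XMod small"
    and null_A: "\<And>Z. crossed_module Z \<Longrightarrow> null A Z \<longleftrightarrow> null (K B) Z \<and> null (K C) Z"
    using null_product_exists[OF u K[OF B] K[OF C]] by blast
  have same_local: "local_xmod small B C f Z \<longleftrightarrow>
      local_xmod small A trivial_xmod (to_trivial A) Z" for Z
  proof (cases "Z \<in> XMod small")
    case True
    have "local_xmod small B C f Z \<longleftrightarrow> null (K B) Z \<and> null (K C) Z"
      using acyclic_null_local[OF L K assms(7)[folded K_def]] B C
        local_if_null_kernels[OF L assms(6) B C assms(4) True, folded K_def] by blast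
    then show ?thesis
      using null_A[OF XModD(1)[OF True]] local_at_to_trivial_iff[OF XModD(1)[OF A] True] by simp
  next
    case False
    then show ?thesis by (simp add: local_xmod_def)
  qed
  have nullification: "is_nullification small A P \<longleftrightarrow> is_localization_at small B C f P" for P
    unfolding is_nullification_def using is_localization_at_cong[OF same_local] by simp
  show ?thesis
    using A L localization_unique[OF L] nullification by blast
qed

end
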